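(* Let $\phi_3(x)=\sqrt2\,\mathrm{sech}(x)$ and $T(x)=\int_{\mathbb R} e^{-\sqrt2|x-y|}\mathrm{sech}^2(y)\,dy$. Define the real functions \[ R_1=-x\phi_3\phi_3'-\tfrac{1}{4\sqrt2}(3-\phi_3^2)T-\tfrac{\phi_3'}{2\sqrt2\,\phi_3}T',\qquad R_2=\tfrac12\phi_3^2+\tfrac{3}{4\sqrt2}T+\tfrac{\phi_3'}{2\sqrt2\,\phi_3}T', \] \[ E=\tfrac12\phi_3\big(\tfrac14-\log\phi_3\big)+\tfrac12 x\phi_3',\qquad F=E+\phi_3\log\phi_3, \] \[ \Delta_1=F\big(3(1-\phi_3^2)^2-1\big)+\phi_3(1-\phi_3^2)^2+6\phi_3(1-\phi_3^2)R_1-2\phi_3R_2,\qquad \Delta_2=F(1-\phi_3^2)+\phi_3R_1+\phi_3(1-\phi_3^2)R_2, \] \[ h_{3,1}=\tfrac12\phi_3^2\cos x+\tfrac{\phi_3'}{\phi_3}\sin x,\qquad h_{3,2}=\tfrac{\phi_3'}{\phi_3}\sin x, \] and, with $\langle f,g\rangle=\int_{\mathbb R} f g\,dx$, \[ \Gamma=\langle\Delta_1,h_{3,1}\rangle+2\langle\Delta_2,h_{3,2}\rangle+\big\langle\big(6x\tanh x\,\mathrm{sech}^2x-\tfrac72\mathrm{sech}^2x\big)\phi_3(1-\phi_3^2),h_{3,1}\big\rangle-2\langle E,h_{3,1}\rangle . \] Then \[ \Gamma=\frac{\pi}{\sqrt2\cosh(\pi/2)}. \]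
   Context: This $\Gamma$ is the first-order coefficient in the expansion $\gamma(p)=(p-3)\Gamma+O((p-3)^2)$ of the nonlinear Fermi Golden Rule constant $\gamma(p)$ for the linearization of the pure power NLS $i\partial_tu-\partial_x^2u-|u|^{p-1}u=0$ on $\mathbb R$ at its ground state, with suitably normalized eigenfunctions; by the authors' earlier work this coefficient is given by the explicit expression above, which is taken here as its definition. All functions are real valued functions of $x\in\mathbb R$, and primes denote $d/dx$. *)

theory Defs
  imports "HOL-Analysis.Analysis"
begin

definition sech :: "real \<Rightarrow> real" where
  "sech x = 1 / cosh x"

definition phi3 :: "real \<Rightarrow> real" where
  "phi3 x = sqrt 2 * sech x"

definition Tfun :: "real \<Rightarrow> real" where
  "Tfun x = (LINT y|lborel. exp (- sqrt 2 * \<bar>x - y\<bar>) * (sech y)\<^sup>2)"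

definition R1 :: "real \<Rightarrow> real" where
  "R1 x = - x * phi3 x * deriv phi3 x
          - 1 / (4 * sqrt 2) * (3 - (phi3 x)\<^sup>2) * Tfun x
          - deriv phi3 x / (2 * sqrt 2 * phi3 x) * deriv Tfun x"

definition R2 :: "real \<Rightarrow> real" where
  "R2 x = 1/2 * (phi3 x)\<^sup>2 + 3 / (4 * sqrt 2) * Tfun x
          + deriv phi3 x / (2 * sqrt 2 * phi3 x) * deriv Tfun x"

definition Efun :: "real \<Rightarrow> real" where
  "Efun x = 1/2 * phi3 x * (1/4 - ln (phi3 x)) + 1/2 * x * deriv phi3 x"

definition Ffun :: "real \<Rightarrow> real" where
  "Ffun x = Efun x + phi3 x * ln (phi3 x)"

definition Delta1 :: "real \<Rightarrow> real" where
  "Delta1 x = Ffun x * (3 * (1 - (phi3 x)\<^sup>2)\<^sup>2 - 1) + phi3 x * (1 - (phi3 x)\<^sup>2)\<^sup>2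
     + 6 * phi3 x * (1 - (phi3 x)\<^sup>2) * R1 x - 2 * phi3 x * R2 x"

definition Delta2 :: "real \<Rightarrow> real" where
  "Delta2 x = Ffun x * (1 - (phi3 x)\<^sup>2) + phi3 x * R1 x + phi3 x * (1 - (phi3 x)\<^sup>2) * R2 x"

definition h31 :: "real \<Rightarrow> real" where
  "h31 x = 1/2 * (phi3 x)\<^sup>2 * cos x + deriv phi3 x / phi3 x * sin x"

definition h32 :: "real \<Rightarrow> real" where
  "h32 x = deriv phi3 x / phi3 x * sin x"

definition ip :: "(real \<Rightarrow> real) \<Rightarrow> (real \<Rightarrow> real) \<Rightarrow> real" where
  "ip f g = (LINT x|lborel. f x * g x)"

definition Gamma_const :: real where
  "Gamma_const = ip Delta1 h31 + 2 * ip Delta2 h32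
     + ip (\<lambda>x. (6 * x * tanh x * (sech x)\<^sup>2 - 7/2 * (sech x)\<^sup>2) * phi3 x * (1 - (phi3 x)\<^sup>2)) h31
     - 2 * ip Efun h31"

end

theory Submission
  imports Defs "HOL-Complex_Analysis.Complex_Analysis" "HOL-Probability.Sinc_Integral"
begin

text \<open>
  The kernel \<open>exp (- sqrt 2 * \<bar>x - y\<bar>)\<close> is a multiple of the Green function of \<open>d\<^sup>2/dx\<^sup>2 - 2\<close>,
  so that \<open>T'' = 2 T - 2 sqrt 2 sech\<^sup>2\<close>. With this relation, the sum of all integrands in \<open>\<Gamma>\<close>
  turns out to be \<open>sqrt 2 (G' + sech x cos x / 2)\<close>, where \<open>G\<close> is an explicit decaying
  polynomial expression in \<open>sech, tanh, sin, cos\<close> that is linear in \<open>x, ln \<phi>\<^sub>3, T, T'\<close>. Hence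
  \<open>\<Gamma> = (1 / sqrt 2) \<integral> sech x cos x dx\<close>, and the last integral is \<open>\<pi> / cosh (\<pi> / 2)\<close> by the residue
  theorem on the rectangle with vertices \<open>\<plusminus>r, \<plusminus>r + \<i>\<pi>\<close>.
\<close>

subsection \<open>Bounded and decaying continuous functions\<close>

lemma sech_pos: "0 < sech x"
  by (simp add: sech_def)

lemma tanh_sq: "(tanh x)\<^sup>2 = 1 - (sech x)\<^sup>2"
proof -
  have "(tanh x)\<^sup>2 = ((cosh x)\<^sup>2 - 1) / (cosh x)\<^sup>2"
    by (simp add: tanh_def power_divide sinh_square_eq)
  then show ?thesis
    by (simp add: sech_def power_divide diff_divide_distrib)
qed

lemma DERIV_sech [derivative_intros]:
  assumes "(g has_real_derivative g') (at x within A)"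
  shows "((\<lambda>x. sech (g x)) has_real_derivative - sech (g x) * tanh (g x) * g') (at x within A)"
  unfolding sech_def using assms
  by (auto intro!: derivative_eq_intros simp: tanh_def field_simps power2_eq_square)

lemma DERIV_tanh_sech: "(tanh has_real_derivative (sech x)\<^sup>2) (at x)"
  by (auto intro!: derivative_eq_intros simp: tanh_sq)

text \<open>A quartic lower bound for \<open>cosh\<close> follows from the quadratic bound
  \<open>1 + y\<^sup>2 / 2 \<le> cosh y\<close> at \<open>y = x / 2\<close>, squared and fed into
  the double angle formula.\<close>

lemma square_one_plus_le_cosh: "(1 + x\<^sup>2)\<^sup>2 \<le> 32 * cosh (x::real)"
proof -
  \<comment> \<open>This is \<open>cosh y = 1 + 2 * (sinh (y / 2))\<^sup>2\<close> combined with
    \<open>u \<le> sinh u\<close> for nonnegative \<open>u\<close>, applied to absolute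
    values.\<close>
  have half: "1 + y\<^sup>2 / 2 \<le> cosh y" for y :: real
  proof -
    have sinh_ge: "u \<le> sinh u" if "u \<ge> 0" for u :: real
    proof -
      have "sinh 0 - 0 \<le> sinh u - u"
        using that
        by (rule DERIV_nonneg_imp_nondecreasing)
           (auto intro!: exI derivative_eq_intros simp: cosh_real_ge_1)
      then show ?thesis by simp
    qed
    have "\<bar>y / 2\<bar>\<^sup>2 \<le> (sinh \<bar>y / 2\<bar>)\<^sup>2"
      by (intro power_mono sinh_ge) auto
    moreover have "cosh (2 * (y / 2)) = 1 + 2 * (sinh (y / 2))\<^sup>2"
      by (simp only: cosh_double cosh_square_eq)
    moreover have "(sinh \<bar>y / 2\<bar>)\<^sup>2 = (sinh (y / 2))\<^sup>2"
      by (simp add: abs_if)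
    ultimately show ?thesis
      by (simp add: power_divide)
  qed
  have "(1 + (x / 2)\<^sup>2 / 2)\<^sup>2 \<le> (cosh (x / 2))\<^sup>2"
    by (intro power_mono half) auto
  moreover have "cosh (2 * (x / 2)) = 2 * (cosh (x / 2))\<^sup>2 - 1"
    by (simp only: cosh_double sinh_square_eq)
  ultimately have "2 * (1 + (x / 2)\<^sup>2 / 2)\<^sup>2 - 1 \<le> cosh x"
    by simp
  \<comment> \<open>The bracket on the right expands to \<open>1 + x^2 / 2 + x^4 / 32\<close>, so
    the factor 32 makes the quartic terms agree.\<close>
  moreover have "(1 + x\<^sup>2)\<^sup>2 \<le> 32 * (2 * (1 + (x / 2)\<^sup>2 / 2)\<^sup>2 - 1)"
    by (simp add: power2_eq_square field_simps)
  ultimately show ?thesis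
    by (meson mult_left_mono order_trans zero_le_numeral)
qed

lemma sech_decay_square: "sech x * (1 + x\<^sup>2)\<^sup>2 \<le> 32"
  using square_one_plus_le_cosh[of x] by (simp add: sech_def field_simps)

lemma sech_decay: "sech x * (1 + x\<^sup>2) \<le> 32"
proof -
  have "sech x * (1 + x\<^sup>2) \<le> sech x * (1 + x\<^sup>2)\<^sup>2"
    by (intro mult_left_mono) (auto simp: power2_eq_square sech_pos less_imp_le mult_le_cancel_left1)
  also note sech_decay_square[of x]
  finally show ?thesis .
qed

lemma cosh_le_exp_abs: "cosh x \<le> exp \<bar>x::real\<bar>"
proof -
  have "(exp x + exp (- x)) / 2 \<le> (exp \<bar>x\<bar> + exp \<bar>x\<bar>) / 2"
    by (intro divide_right_mono add_mono) auto
  then show ?thesis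
    unfolding cosh_field_def by simp
qed

lemma exp_abs_le_sech: "exp (- \<bar>x\<bar>) \<le> sech x"
  using cosh_le_exp_abs[of x] by (simp add: sech_def exp_minus field_simps)

lemma sech_le_exp_abs: "sech x \<le> 2 * exp (- \<bar>x\<bar>)"
proof -
  have "exp \<bar>x\<bar> \<le> 2 * cosh x"
    by (cases "x \<ge> 0") (auto simp: cosh_field_def)
  then show ?thesis
    by (simp add: sech_def exp_minus field_simps)
qed

section \<open>Two classes of functions closed under the operations that occur in the
  integrands\<close>

definition bounded_cont :: "(real \<Rightarrow> real) \<Rightarrow> bool" where
  "bounded_cont f \<longleftrightarrow> continuous_on UNIV f \<and> (\<exists>C. \<forall>x. \<bar>f x\<bar> \<le> C)"

text \<open>The weight \<open>1 + x\<^sup>2\<close> is enough for both purposes of the class: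
  integrability over the line and vanishing boundary terms at infinity. Its products with
  \<open>bounded_cont\<close> functions stay in the class, so membership can be read off from the
  syntax of an expression by \<open>decay_intros\<close>.\<close>

definition decaying :: "(real \<Rightarrow> real) \<Rightarrow> bool" where
  "decaying f \<longleftrightarrow> continuous_on UNIV f \<and> (\<exists>C. \<forall>x. \<bar>f x\<bar> * (1 + x\<^sup>2) \<le> C)"

named_theorems decay_intros

lemma bounded_contI:
  assumes "continuous_on UNIV f" "\<And>x. \<bar>f x\<bar> \<le> C"
  shows "bounded_cont f"
  using assms by (auto simp: bounded_cont_def)

lemma decayingI:
  assumes "continuous_on UNIV f" "\<And>x. \<bar>f x\<bar> * (1 + x\<^sup>2) \<le> C"
  shows "decaying f"
  using assms by (auto simp: decaying_def)

lemma decaying_imp_bounded_cont: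
  assumes "decaying f" shows "bounded_cont f"
proof -
  obtain C where C: "\<And>x. \<bar>f x\<bar> * (1 + x\<^sup>2) \<le> C" and "continuous_on UNIV f"
    using assms by (auto simp: decaying_def)
  moreover have "\<bar>f x\<bar> \<le> \<bar>f x\<bar> * (1 + x\<^sup>2)" for x
    by (simp add: mult_le_cancel_left1)
  ultimately show ?thesis
    by (meson bounded_contI order_trans)
qed

lemma bounded_cont_const [decay_intros]: "bounded_cont (\<lambda>x. c)"
  by (rule bounded_contI[where C = "\<bar>c\<bar>"]) auto

lemma bounded_cont_sin [decay_intros]: "bounded_cont sin"
  and bounded_cont_cos [decay_intros]: "bounded_cont cos"
  by (rule bounded_contI[where C = 1]; auto intro!: continuous_intros)+

lemma bounded_cont_add [decay_intros]:
  assumes "bounded_cont f" "bounded_cont g"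
  shows "bounded_cont (\<lambda>x. f x + g x)"
proof -
  obtain C D where "\<And>x. \<bar>f x\<bar> \<le> C" "\<And>x. \<bar>g x\<bar> \<le> D"
    using assms by (auto simp: bounded_cont_def)
  then have "\<bar>f x + g x\<bar> \<le> C + D" for x
    by (metis abs_triangle_ineq add_mono order_trans)
  then show ?thesis
    using assms by (auto simp: bounded_cont_def intro!: continuous_intros)
qed

lemma bounded_cont_mult [decay_intros]:
  assumes "bounded_cont f" "bounded_cont g"
  shows "bounded_cont (\<lambda>x. f x * g x)"
proof -
  obtain C D where "\<And>x. \<bar>f x\<bar> \<le> C" "\<And>x. \<bar>g x\<bar> \<le> D"
    using assms by (auto simp: bounded_cont_def)
  then have "\<bar>f x * g x\<bar> \<le> C * D" for x
    unfolding abs_mult by (metis abs_ge_zero mult_mono order_trans)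
  then show ?thesis
    using assms by (auto simp: bounded_cont_def intro!: continuous_intros)
qed

lemma bounded_cont_diff [decay_intros]:
  assumes "bounded_cont f" "bounded_cont g"
  shows "bounded_cont (\<lambda>x. f x - g x)"
  using bounded_cont_add[OF assms(1) bounded_cont_mult[OF bounded_cont_const[of "-1"] assms(2)]]
  by simp

lemma bounded_cont_power [decay_intros]:
  assumes "bounded_cont f"
  shows "bounded_cont (\<lambda>x. f x ^ n)"
  by (induction n) (auto intro!: decay_intros assms)

lemma decaying_mult_bounded [decay_intros]:
  assumes "decaying f" "bounded_cont g"
  shows "decaying (\<lambda>x. f x * g x)"
proof -
  obtain C D where CD: "\<And>x. \<bar>f x\<bar> * (1 + x\<^sup>2) \<le> C" "\<And>x. \<bar>g x\<bar> \<le> D"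
    using assms by (auto simp: decaying_def bounded_cont_def)
  have "0 \<le> C"
    using CD(1)[of 0] by simp
  then have "(\<bar>f x\<bar> * (1 + x\<^sup>2)) * \<bar>g x\<bar> \<le> C * D" for x
    by (intro mult_mono CD) auto
  then show ?thesis
    using assms
    by (auto simp: decaying_def bounded_cont_def abs_mult mult_ac intro!: continuous_intros)
qed

text \<open>The mirrored product rule is kept out of \<open>decay_intros\<close>, so that these
  rules always look for the decaying factor on the left of a product. Expressions below are arranged
  accordingly.\<close>

lemma decaying_bounded_mult:
  assumes "bounded_cont f" "decaying g"
  shows "decaying (\<lambda>x. f x * g x)"
  using decaying_mult_bounded[OF assms(2,1)] by (simp add: mult.commute)

lemma decaying_add [decay_intros]:
  assumes "decaying f" "decaying g"
  shows "decaying (\<lambda>x. f x + g x)"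
proof -
  obtain C D where CD: "\<And>x. \<bar>f x\<bar> * (1 + x\<^sup>2) \<le> C" "\<And>x. \<bar>g x\<bar> * (1 + x\<^sup>2) \<le> D"
    using assms by (auto simp: decaying_def)
  have "\<bar>f x + g x\<bar> * (1 + x\<^sup>2) \<le> C + D" for x
  proof -
    have "\<bar>f x + g x\<bar> * (1 + x\<^sup>2) \<le> (\<bar>f x\<bar> + \<bar>g x\<bar>) * (1 + x\<^sup>2)"
      by (intro mult_right_mono abs_triangle_ineq) auto
    then show ?thesis
      using CD[of x] by (simp add: distrib_right)
  qed
  then show ?thesis
    using assms by (auto simp: decaying_def intro!: continuous_intros)
qed

lemma decaying_diff [decay_intros]:
  assumes "decaying f" "decaying g"
  shows "decaying (\<lambda>x. f x - g x)"
  using decaying_add[OF assms(1) decaying_bounded_mult[OF bounded_cont_const[of "-1"] assms(2)]]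
  by simp

lemma decaying_bound:
  assumes "decaying f"
  obtains C where "C \<ge> 0" "\<And>x. \<bar>f x\<bar> \<le> C * inverse (1 + x\<^sup>2)"
proof -
  obtain C where C: "\<And>x. \<bar>f x\<bar> * (1 + x\<^sup>2) \<le> C"
    using assms by (auto simp: decaying_def)
  have "0 \<le> C" using C[of 0] by simp
  moreover have "\<bar>f x\<bar> \<le> C * inverse (1 + x\<^sup>2)" for x
    using C[of x] by (simp add: field_simps add_pos_nonneg)
  ultimately show ?thesis by (rule that)
qed

lemma decaying_integrable:
  assumes "decaying f"
  shows "integrable lborel f"
proof -
  obtain C where C: "C \<ge> 0" "\<And>x. \<bar>f x\<bar> \<le> C * inverse (1 + x\<^sup>2)"
    by (rule decaying_bound[OF assms]) blast
  have "integrable lborel (\<lambda>x::real. inverse (1 + x\<^sup>2))"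
    using integrable_inverse_1_plus_square by (simp add: set_integrable_def einterval_def)
  then have "integrable lborel (\<lambda>x. C * inverse (1 + x\<^sup>2))"
    by simp
  moreover have "f \<in> borel_measurable lborel"
    using assms by (simp add: decaying_def borel_measurable_continuous_onI)
  ultimately show ?thesis
    by (rule Bochner_Integration.integrable_bound) (use C in \<open>auto intro!: AE_I2\<close>)
qed

lemma decaying_tendsto_0:
  assumes "decaying f"
  shows "(f \<longlongrightarrow> 0) at_infinity"
proof -
  obtain C where C: "C \<ge> 0" "\<And>x. \<bar>f x\<bar> \<le> C * inverse (1 + x\<^sup>2)"
    by (rule decaying_bound[OF assms]) blast
  have "((\<lambda>x::real. C * inverse (1 + x\<^sup>2)) \<longlongrightarrow> C * 0) at_infinity"
    unfolding at_infinity_eq_at_top_bot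
    by (intro tendsto_mult tendsto_const filterlim_sup; real_asymp)
  then show ?thesis
    by (rule_tac Lim_null_comparison) (use C in auto)
qed

section \<open>Integrals over the line as limits over symmetric intervals\<close>

text \<open>Dominated convergence with dominating function \<open>\<bar>f x\<bar>\<close>: at each
  \<open>x\<close> the truncated integrand equals \<open>f x\<close> as soon as
  \<open>n \<ge> \<bar>x\<bar>\<close>.\<close>

lemma tendsto_integral_symmetric_interval:
  fixes f :: "real \<Rightarrow> real"
  assumes "integrable lborel f"
  shows "(\<lambda>n. integral {- real n..real n} f) \<longlonglongrightarrow> (LINT x|lborel. f x)"
proof -
  have "(\<lambda>n. LINT x|lborel. indicator {- real n..real n} x *\<^sub>R f x) \<longlonglongrightarrow> (LINT x|lborel. f x)"
  proof (rule integral_dominated_convergence[where w = "\<lambda>x. \<bar>f x\<bar>"])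
    show "AE x in lborel. (\<lambda>n. indicator {- real n..real n} x *\<^sub>R f x) \<longlonglongrightarrow> f x"
    proof (rule AE_I2, rule tendsto_eventually)
      fix x :: real
      show "\<forall>\<^sub>F n in sequentially. indicator {- real n..real n} x *\<^sub>R f x = f x"
        using eventually_ge_at_top[of "nat \<lceil>\<bar>x\<bar>\<rceil>"]
        by eventually_elim (auto simp: indicator_def; linarith)
    qed
  qed (use assms in \<open>auto simp: indicator_def\<close>)
  moreover have "(LINT x|lborel. indicator {- real n..real n} x *\<^sub>R f x) = integral {- real n..real n} f" for n
    using set_borel_integral_eq_integral(2)[of "{- real n..real n}" f]
      integrable_mult_indicator[OF _ assms, of "{- real n..real n}"]
    by (simp add: set_lebesgue_integral_def set_integrable_def)
  ultimately show ?thesis by simp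
qed

text \<open>The fundamental theorem of calculus on \<open>{- real n..real n}\<close> leaves only
  boundary values of \<open>G\<close>, which tend to 0.\<close>

lemma integral_deriv_decaying:
  assumes G: "decaying G" and g: "integrable lborel g"
    and deriv: "\<And>x. (G has_real_derivative g x) (at x)"
  shows "(LINT x|lborel. g x) = 0"
proof -
  have "integral {- real n..real n} g = G (real n) - G (- real n)" for n
    using deriv
    by (intro integral_unique fundamental_theorem_of_calculus)
       (auto intro: has_field_derivative_at_within simp flip: has_real_derivative_iff_has_vector_derivative)
  moreover have "(\<lambda>n. G (real n) - G (- real n)) \<longlonglongrightarrow> 0 - 0"
    by (intro tendsto_diff filterlim_compose[OF decaying_tendsto_0[OF G]])
       (auto simp: filterlim_at_infinity_conv_norm_at_top filterlim_real_sequentially)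
  ultimately have "(\<lambda>n. integral {- real n..real n} g) \<longlonglongrightarrow> 0"
    by simp
  then show ?thesis
    using tendsto_integral_symmetric_interval[OF g] LIMSEQ_unique by blast
qed

section \<open>Decay of sech and of its products with slowly growing factors\<close>

lemma continuous_on_sech [continuous_intros]:
  "continuous_on A f \<Longrightarrow> continuous_on A (\<lambda>x. sech (f x))"
  unfolding sech_def by (intro continuous_intros) auto

lemma decaying_sech [decay_intros]: "decaying sech"
  using sech_decay sech_pos
  by (intro decayingI[where C = 32] continuous_intros) (simp add: less_imp_le)

text \<open>Of the two factors \<open>1 + x\<^sup>2\<close> available in
  \<open>sech_decay_square\<close>, one absorbs the growth of \<open>f\<close> and the other remains
  as the decay weight.\<close>

lemma decaying_mult_sech:
  assumes cont: "continuous_on UNIV f" and le: "\<And>x. \<bar>f x\<bar> \<le> C * (1 + x\<^sup>2)"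
  shows "decaying (\<lambda>x. f x * sech x)"
proof (rule decayingI[where C = "C * 32"])
  have C: "0 \<le> C" using le[of 0] by simp
  fix x
  have "\<bar>f x * sech x\<bar> * (1 + x\<^sup>2) = \<bar>f x\<bar> * (sech x * (1 + x\<^sup>2))"
    using sech_pos[of x] by (simp add: abs_mult)
  also have "\<dots> \<le> (C * (1 + x\<^sup>2)) * (sech x * (1 + x\<^sup>2))"
    using sech_pos[of x] by (intro mult_right_mono le) auto
  also have "\<dots> = C * (sech x * (1 + x\<^sup>2)\<^sup>2)"
    by (simp add: power2_eq_square)
  also have "\<dots> \<le> C * 32"
    by (intro mult_left_mono sech_decay_square C)
  finally show "\<bar>f x * sech x\<bar> * (1 + x\<^sup>2) \<le> C * 32" .
qed (intro continuous_intros cont)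

lemma abs_le_one_plus_square: "\<bar>x\<bar> \<le> 1 + (x::real)\<^sup>2"
  using zero_le_power2[of "\<bar>x\<bar> - 1"] zero_le_power2[of x] by (simp add: power2_diff)

lemma decaying_times_sech [decay_intros]: "decaying (\<lambda>x. x * sech x)"
  by (rule decaying_mult_sech[where C = 1]) (auto intro: abs_le_one_plus_square)

text \<open>The logarithm grows at most linearly, since
  \<open>ln (phi3 x) = ln 2 / 2 - ln (cosh x)\<close> and \<open>ln (cosh x)\<close> lies between 0
  and \<open>\<bar>x\<bar>\<close>.\<close>

lemma decaying_ln_sech [decay_intros]: "decaying (\<lambda>x. ln (phi3 x) * sech x)"
proof (rule decaying_mult_sech[where C = 2])
  show "continuous_on UNIV (\<lambda>x. ln (phi3 x))"
    unfolding phi3_def using sech_pos by (intro continuous_intros) (auto simp: less_imp_neq[symmetric])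
  fix x :: real
  have "ln (cosh x) \<le> \<bar>x\<bar>"
    by (metis cosh_le_exp_abs cosh_real_pos ln_exp ln_le_cancel_iff exp_gt_zero)
  moreover have "0 \<le> ln (cosh x)"
    by (simp add: cosh_real_ge_1)
  moreover have "ln (phi3 x) = ln 2 / 2 - ln (cosh x)"
    by (simp add: phi3_def sech_def ln_mult ln_div ln_sqrt)
  moreover have "0 \<le> ln (2::real)" "ln (2::real) \<le> 1"
    using ln_le_minus_one[of 2] by auto
  ultimately show "\<bar>ln (phi3 x)\<bar> \<le> 2 * (1 + x\<^sup>2)"
    using abs_le_one_plus_square[of x] zero_le_power2[of x]
    by (simp only: abs_le_iff[of "ln (phi3 x)"] distrib_left)
qed

lemma bounded_cont_sech [decay_intros]: "bounded_cont sech"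
  by (rule decaying_imp_bounded_cont decaying_sech)+

lemma bounded_cont_tanh [decay_intros]: "bounded_cont tanh"
  by (rule bounded_contI[where C = 1])
     (auto intro!: continuous_intros simp: abs_le_iff less_imp_le tanh_real_gt_neg1 tanh_real_lt_1 minus_le_iff)

subsection \<open>The Fourier transform of the hyperbolic secant\<close>

text \<open>The zeros of \<open>cosh\<close> are the odd multiples of
  \<open>\<i> * (pi / 2)\<close>. The strip is an open neighbourhood of the closed strip between
  heights 0 and pi, yet narrow enough to contain a single zero.\<close>

lemma cosh_complex_eq_0_iff:
  fixes z :: complex
  assumes "-1 < Im z" "Im z < 4"
  shows "cosh z = 0 \<longleftrightarrow> z = \<i> * (pi / 2)"
proof
  assume "cosh z = 0"
  then obtain n :: int where n: "\<i> * z = complex_of_real (n * pi) + of_real pi / 2"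
    by (auto simp: cosh_conv_cos cos_eq_0)
  have re: "Re z = 0"
    using arg_cong[OF n, of Im] by simp
  have im: "Im z = - (real_of_int n * pi) - pi / 2"
    using arg_cong[OF n, of Re] by simp
  \<comment> \<open>If \<open>n \<le> -2\<close> then \<open>Im z\<close> is at least
    \<open>3 * pi / 2\<close>, above 4; if \<open>n \<ge> 0\<close> it is at most
    \<open>- pi / 2\<close>, below -1.\<close>
  have "\<not> n \<le> -2"
  proof
    assume "n \<le> -2"
    then have "real_of_int n * pi \<le> -2 * pi"
      by (intro mult_right_mono) auto
    then show False
      using assms im pi_gt3 by simp
  qed
  moreover have "\<not> n \<ge> 0"
  proof
    assume "n \<ge> 0"
    then have "real_of_int n * pi \<ge> 0"
      by (intro mult_nonneg_nonneg) auto
    then show False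
      using assms im pi_gt3 by simp
  qed
  ultimately have "n = -1"
    by linarith
  then show "z = \<i> * (pi / 2)"
    using re im by (simp add: complex_eq_iff)
next
  assume "z = \<i> * (pi / 2)"
  then have "\<i> * z = - complex_of_real (pi / 2)"
    by (simp only: mult.assoc[symmetric] i_squared) simp
  then show "cosh z = 0"
    unfolding cosh_conv_cos by (simp only: cos_minus cos_of_real) simp
qed

lemma cosh_holomorphic_on [holomorphic_intros]: "cosh holomorphic_on A"
  unfolding cosh_conv_cos[abs_def] by (intro holomorphic_intros)

text \<open>Reverse triangle inequality: \<open>exp z\<close> and \<open>exp (- z)\<close> have
  norms \<open>exp (Re z)\<close> and \<open>exp (- Re z)\<close>, and half their difference is
  \<open>sinh (Re z)\<close>.\<close>

lemma norm_cosh_ge: "\<bar>sinh (Re z)\<bar> \<le> norm (cosh z)"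
proof -
  have "\<bar>norm (exp z) - norm (- exp (- z))\<bar> \<le> norm (exp z - (- exp (- z)))"
    by (rule norm_triangle_ineq3)
  then show ?thesis
    by (simp add: cosh_def sinh_def norm_exp_eq_Re scaleR_conv_of_real norm_mult)
qed

text \<open>The height pi is chosen because \<open>f (z + \<i> * pi)\<close> is
  \<open>- exp (- pi)\<close> times \<open>f z\<close>: the top edge repeats the bottom integral up
  to the factor \<open>exp (- pi)\<close>. The rectangle encloses one simple pole, whose
  contribution is \<open>2 * pi * exp (- pi / 2)\<close>. The error is the integral over the two
  vertical edges.\<close>

lemma exp_i_div_cosh_rectangle:
  fixes r :: real and f :: "complex \<Rightarrow> complex"
  assumes r: "r > 0"
  defines "f \<equiv> \<lambda>z. exp (\<i> * z) / cosh z"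
  shows "norm ((1 + exp (- pi)) * integral {-r..r} (\<lambda>x. f (of_real x)) - 2 * pi * exp (- pi / 2))
    \<le> 2 * pi / sinh r"
proof -
  define S where "S = {z::complex. -1 < Im z \<and> Im z < 4}"
  define p where "p = \<i> * complex_of_real (pi / 2)"
  define a b c d where "a = Complex (-r) 0" and "b = Complex r 0" and "c = Complex r pi" and "d = Complex (-r) pi"
  have S: "open S" "convex S"
  proof -
    have eq: "S = {z. Im z > -1} \<inter> {z. Im z < 4}"
      by (auto simp: S_def)
    show "open S"
      unfolding eq by (intro open_Int open_halfspace_Im_gt open_halfspace_Im_lt)
    show "convex S"
      unfolding eq by (intro convex_Int convex_halfspace_Im_gt convex_halfspace_Im_lt)
  qed
  have pi4: "pi < 4" "-1 < pi" using pi_less_4 pi_gt_zero by linarith+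
  have hol: "f holomorphic_on S - {p}"
    unfolding f_def
    by (intro holomorphic_intros) (auto simp: S_def p_def cosh_complex_eq_0_iff)
  have box_sub: "cbox a c \<subseteq> S"
    using pi4 by (auto simp: S_def a_def c_def in_cbox_complex_iff)
  have p_in: "p \<in> box a c"
    using r by (auto simp: p_def a_def c_def in_box_complex_iff)
  have image_rect: "path_image (rectpath a c) \<subseteq> S - {p}"
    using path_image_rectpath_cbox_minus_box[of a c] r box_sub p_in by (auto simp: a_def c_def)
  have wind: "winding_number (rectpath a c) z = 0" if "z \<notin> S" for z
    using that box_sub r by (intro winding_number_rectpath_outside) (auto simp: a_def c_def)
  \<comment> \<open>For a quotient with a simple pole the residue is the numerator divided by the
    derivative of the denominator; here \<open>sinh p = \<i>\<close> and
    \<open>exp (\<i> * p) = exp (- pi / 2)\<close>.\<close>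
  have res: "residue f p = exp (- pi / 2) / \<i>"
  proof -
    have sinh_p: "sinh p = \<i>"
    proof -
      have "\<i> * p = - complex_of_real (pi / 2)"
        by (simp add: p_def)
      then show ?thesis
        unfolding sinh_conv_sin by (simp only: sin_minus sin_of_real) simp
    qed
    have "residue f p = exp (\<i> * p) / \<i>"
      unfolding f_def
    proof (rule residue_simple_pole_deriv[where s = UNIV])
      show "(cosh has_field_derivative \<i>) (at p)"
        using sinh_p by (auto intro!: derivative_eq_intros)
      show "cosh p = 0"
        using pi4 by (subst cosh_complex_eq_0_iff) (auto simp: p_def pi_gt_zero less_trans[OF _ pi_gt_zero])
    qed (auto intro!: holomorphic_intros)
    also have "\<i> * p = of_real (- pi / 2)"
      by (simp add: p_def)
    finally show ?thesis
      by (simp only: exp_of_real)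
  qed
  have total: "contour_integral (rectpath a c) f = 2 * pi * exp (- pi / 2)"
  proof -
    have "contour_integral (rectpath a c) f
        = 2 * pi * \<i> * (\<Sum>p\<in>{p}. winding_number (rectpath a c) p * residue f p)"
      by (rule Residue_theorem[OF S(1) convex_connected[OF S(2)] _ hol valid_path_rectpath _ image_rect])
         (simp, simp, use wind in blast)
    also have "(\<Sum>p\<in>{p}. winding_number (rectpath a c) p * residue f p) = exp (- pi / 2) / \<i>"
      unfolding res[symmetric] using winding_number_rectpath[OF p_in] by simp
    also have "2 * pi * \<i> * (exp (- pi / 2) / \<i>) = complex_of_real (2 * pi * exp (- pi / 2))"
    proof -
      have "u * \<i> * (v / \<i>) = u * v" for u v
        by (simp add: algebra_simps)
      then show ?thesis
        by (simp only: of_real_mult)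
    qed
    finally show ?thesis .
  qed
  have seg_int: "f contour_integrable_on linepath u v"
    if "closed_segment u v \<subseteq> path_image (rectpath a c)" for u v
    using that image_rect hol
    by (intro contour_integrable_continuous_linepath holomorphic_on_imp_continuous_on)
       (meson holomorphic_on_subset subset_trans)
  have img: "path_image (rectpath a c) = closed_segment a b \<union> closed_segment b c \<union>
      closed_segment c d \<union> closed_segment d a"
    by (simp add: rectpath_def Let_def path_image_join a_def b_def c_def d_def Un_assoc)
  have ints: "f contour_integrable_on linepath a b" "f contour_integrable_on linepath b c"
    "f contour_integrable_on linepath c d" "f contour_integrable_on linepath d a"
    by (intro seg_int; simp add: img; blast)+
  have split: "contour_integral (rectpath a c) f = contour_integral (linepath a b) f +
      contour_integral (linepath b c) f + contour_integral (linepath c d) f + contour_integral (linepath d a) f"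
  proof -
    have "rectpath a c = linepath a b +++ linepath b c +++ linepath c d +++ linepath d a"
      by (simp add: rectpath_def Let_def a_def b_def c_def d_def)
    then show ?thesis
      using ints by (simp add: contour_integrable_join valid_path_join)
  qed
  have bottom: "contour_integral (linepath a b) f = integral {-r..r} (\<lambda>x. f (of_real x))"
    using r by (subst contour_integral_linepath_Reals_eq) (auto simp: a_def b_def complex_is_Real_iff)
  have periodic: "f (z + \<i> * pi) = - exp (- pi) * f z" for z
  proof -
    have 1: "exp (\<i> * (z + \<i> * pi)) = exp (\<i> * z) * exp (- pi)"
    proof -
      have "\<i> * (z + \<i> * pi) = \<i> * z + of_real (- pi)"
        by (simp add: distrib_left)
      then show ?thesis
        by (simp only: exp_add exp_of_real)
    qed
    have 2: "cosh (z + \<i> * pi) = - cosh z"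
    proof -
      have "exp (z + \<i> * pi) = - exp z"
        by (simp add: exp_add)
      moreover from this have "exp (- (z + \<i> * pi)) = - exp (- z)"
        by (simp only: exp_minus inverse_minus_eq)
      ultimately show ?thesis
        unfolding cosh_field_def by (simp only: minus_add_distrib minus_divide_left)
    qed
    show ?thesis
      unfolding f_def 1 2 by simp
  qed
  \<comment> \<open>The edge from \<open>c\<close> to \<open>d\<close> runs from right to left.
    Reversed, it is the bottom edge shifted by \<open>\<i> * pi\<close>, so the sign from the
    reversal cancels the sign in \<open>periodic\<close>.\<close>
  have top: "contour_integral (linepath c d) f = exp (- pi) * contour_integral (linepath a b) f"
  proof -
    have "linepath d c = (+) (\<i> * pi) \<circ> linepath a b"
      by (auto simp: linepath_def fun_eq_iff a_def b_def c_def d_def complex_eq_iff algebra_simps)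
    then have "contour_integral (linepath d c) f = contour_integral (linepath a b) (\<lambda>z. f (z + \<i> * pi))"
      by (simp only: contour_integral_translate)
    also have "\<dots> = - exp (- pi) * contour_integral (linepath a b) f"
      unfolding periodic by (rule contour_integral_lmul[OF ints(1)])
    finally show ?thesis
      by (subst contour_integral_reverse_linepath)
        (use ints hol image_rect img in \<open>auto intro!: holomorphic_on_imp_continuous_on elim: holomorphic_on_subset\<close>)
  qed
  \<comment> \<open>On a vertical edge the numerator has norm \<open>exp (- Im z) \<le> 1\<close>,
    the denominator has norm at least \<open>sinh r\<close>, and the edge has length pi.\<close>
  have side: "norm (contour_integral (linepath u v) f) \<le> pi / sinh r"
    if "f contour_integrable_on linepath u v" "dist u v = pi"
       "closed_segment u v \<subseteq> {z. \<bar>Re z\<bar> = r \<and> Im z \<ge> 0}" for u v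
  proof -
    have "norm (contour_integral (linepath u v) f) \<le> 1 / sinh r * norm (v - u)"
    proof (rule contour_integral_bound_linepath)
      fix z assume "z \<in> closed_segment u v"
      then have z: "\<bar>Re z\<bar> = r" "Im z \<ge> 0" using that by auto
      have "sinh r \<le> norm (cosh z)"
        using norm_cosh_ge[of z] z r by (cases "Re z \<ge> 0") auto
      moreover have "norm (exp (\<i> * z)) \<le> 1"
        using z by (simp add: norm_exp_eq_Re)
      ultimately show "norm (f z) \<le> 1 / sinh r"
        using r unfolding f_def norm_divide by (intro frac_le) auto
    qed (use r that in auto)
    then show ?thesis
      using that by (simp add: dist_norm norm_minus_commute)
  qed
  have vert: "norm (contour_integral (linepath b c) f) \<le> pi / sinh r"
    "norm (contour_integral (linepath d a) f) \<le> pi / sinh r"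
  proof -
    have "closed_segment b c \<subseteq> {z. \<bar>Re z\<bar> = r \<and> Im z \<ge> 0}"
      "closed_segment d a \<subseteq> {z. \<bar>Re z\<bar> = r \<and> Im z \<ge> 0}"
      using r by (auto simp: b_def c_def a_def d_def closed_segment_same_Re closed_segment_eq_real_ivl)
    moreover have "dist b c = pi" "dist d a = pi"
      by (auto simp: b_def c_def a_def d_def dist_norm cmod_def)
    ultimately show "norm (contour_integral (linepath b c) f) \<le> pi / sinh r"
      "norm (contour_integral (linepath d a) f) \<le> pi / sinh r"
      by (auto intro!: side ints)
  qed
  have "(1 + exp (- pi)) * integral {-r..r} (\<lambda>x. f (of_real x)) - 2 * pi * exp (- pi / 2)
    = - (contour_integral (linepath b c) f + contour_integral (linepath d a) f)"
    using total split bottom top by (simp add: algebra_simps)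
  then have "norm ((1 + exp (- pi)) * integral {-r..r} (\<lambda>x. f (of_real x)) - 2 * pi * exp (- pi / 2))
    \<le> norm (contour_integral (linepath b c) f) + norm (contour_integral (linepath d a) f)"
    by (simp only: norm_minus_cancel norm_triangle_ineq)
  then show ?thesis
    using vert by simp
qed

text \<open>On the real axis \<open>f\<close> has real part \<open>sech x * cos x\<close>. Taking
  real parts in the rectangle estimate with \<open>r = n\<close> and letting \<open>n\<close> tend
  to infinity gives \<open>(1 + exp (- pi)) * I = 2 * pi * exp (- pi / 2)\<close>.\<close>

lemma integral_sech_cos: "(LINT x|lborel. sech x * cos x) = pi / cosh (pi / 2)"
proof -
  define I where "I = (LINT x|lborel. sech x * cos x)"
  define f where "f = (\<lambda>z::complex. exp (\<i> * z) / cosh z)"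
  define J where "J = (\<lambda>n. integral {- real n..real n} (\<lambda>x. sech x * cos x))"
  have bound: "norm ((1 + exp (- pi)) * J n - 2 * pi * exp (- pi / 2)) \<le> 2 * pi / sinh (real n)" if "n > 0" for n
  proof -
    let ?K = "integral {- real n..real n} (\<lambda>x. f (of_real x))"
    have cosh_of_real: "cosh (complex_of_real x) = of_real (cosh x)" for x
      by (simp add: cosh_field_def exp_of_real[symmetric])
    have f_eq: "f (of_real x) = cis x / of_real (cosh x)" for x
      by (simp add: f_def cosh_of_real cis_conv_exp)
    have "(\<lambda>x. f (of_real x)) integrable_on {- real n..real n}"
      unfolding f_eq by (intro integrable_continuous_interval continuous_intros) auto
    then have "Re ?K = integral {- real n..real n} (\<lambda>x. Re (f (of_real x)))"
      using integral_linear[OF _ bounded_linear_Re, of "\<lambda>x. f (of_real x)"] by (simp add: o_def)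
    also have "\<dots> = J n"
      by (simp add: J_def f_eq sech_def Re_divide_of_real)
    finally have "(1 + exp (- pi)) * J n - 2 * pi * exp (- pi / 2)
        = Re (complex_of_real (1 + exp (- pi)) * ?K - complex_of_real (2 * pi * exp (- pi / 2)))"
      by simp
    also have "\<bar>\<dots>\<bar> \<le> norm (complex_of_real (1 + exp (- pi)) * ?K - complex_of_real (2 * pi * exp (- pi / 2)))"
      by (rule abs_Re_le_cmod)
    also have "\<dots> \<le> 2 * pi / sinh (real n)"
      using exp_i_div_cosh_rectangle[of "real n"] that by (simp add: f_def)
    finally show ?thesis by simp
  qed
  have "integrable lborel (\<lambda>x. sech x * cos x)"
    by (intro decaying_integrable decay_intros)
  then have "J \<longlonglongrightarrow> I"
    unfolding J_def I_def by (rule tendsto_integral_symmetric_interval)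
  then have "(\<lambda>n. (1 + exp (- pi)) * J n - 2 * pi * exp (- pi / 2)) \<longlonglongrightarrow> (1 + exp (- pi)) * I - 2 * pi * exp (- pi / 2)"
    by (intro tendsto_intros)
  moreover have "(\<lambda>n. (1 + exp (- pi)) * J n - 2 * pi * exp (- pi / 2)) \<longlonglongrightarrow> 0"
  proof (rule Lim_null_comparison)
    show "\<forall>\<^sub>F n in sequentially. norm ((1 + exp (- pi)) * J n - 2 * pi * exp (- pi / 2)) \<le> 2 * pi / sinh (real n)"
      using eventually_gt_at_top[of 0] by eventually_elim (rule bound)
    have "((\<lambda>x::real. 2 * pi / sinh x) \<longlongrightarrow> 0) at_top"
      by (rule tendsto_divide_0[OF tendsto_const filterlim_at_top_imp_at_infinity[OF sinh_real_at_top]])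
    then show "(\<lambda>n. 2 * pi / sinh (real n)) \<longlonglongrightarrow> 0"
      by (rule filterlim_compose) (rule filterlim_real_sequentially)
  qed
  ultimately have eq: "(1 + exp (- pi)) * I = 2 * pi * exp (- pi / 2)"
    using LIMSEQ_unique by fastforce
  \<comment> \<open>In terms of \<open>e\<close> both \<open>exp (- pi)\<close> and
    \<open>cosh (pi / 2)\<close> are rational expressions, so the value of \<open>I\<close> follows
    by field arithmetic.\<close>
  define e where "e = exp (- pi / 2)"
  have e: "exp (- pi) = e * e" "e > 0" "exp (pi / 2) = inverse e"
    by (simp_all add: e_def flip: exp_add exp_minus)
  have cosh_eq: "cosh (pi / 2) = (1 + e * e) / (2 * e)"
    unfolding cosh_field_def using e(2,3) by (simp add: e_def field_simps)
  have "1 + e * e > 0"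
    by (simp add: add_pos_nonneg)
  then show ?thesis
    using eq e(2) unfolding I_def[symmetric] cosh_eq e(1) e_def[symmetric] by (simp add: field_simps)
qed

subsection \<open>The differential equation for \<open>T\<close>\<close>

text \<open>The half-line is cut at \<open>a = x - 1\<close>. For \<open>u > a\<close> the part
  below \<open>a\<close> is constant in \<open>u\<close>, and the compact part is differentiated by
  the fundamental theorem of calculus.\<close>

lemma has_real_derivative_integral_atMost:
  fixes g :: "real \<Rightarrow> real"
  assumes cont: "continuous_on UNIV g" and int: "integrable lborel g"
  shows "((\<lambda>x. LINT y|lborel. indicator {..x} y * g y) has_real_derivative g x) (at x)"
proof -
  define a where "a = x - 1"
  have int_ind: "integrable lborel (\<lambda>y. indicator A y * g y)" if "A \<in> sets borel" for A
    using integrable_mult_indicator[OF _ int, of A] that by simp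
  have split: "(LINT y|lborel. indicator {..u} y * g y) = (LINT y|lborel. indicator {..<a} y * g y) + integral {a..u} g"
    if "u > a" for u
  proof -
    have "(LINT y|lborel. indicator {..u} y * g y)
        = (LINT y|lborel. indicator {..<a} y * g y + indicator {a..u} y * g y)"
      using that by (intro Bochner_Integration.integral_cong) (auto simp: indicator_def)
    also have "\<dots> = (LINT y|lborel. indicator {..<a} y * g y) + (LINT y|lborel. indicator {a..u} y * g y)"
      by (intro Bochner_Integration.integral_add int_ind) auto
    also have "(LINT y|lborel. indicator {a..u} y * g y) = integral {a..u} g"
      using set_borel_integral_eq_integral(2)[of "{a..u}" g] int_ind[of "{a..u}"]
      by (simp add: set_lebesgue_integral_def set_integrable_def)
    finally show ?thesis .
  qed
  have "((\<lambda>u. integral {a..u} g) has_real_derivative g x) (at x within {a..x + 1})"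
    by (rule integral_has_real_derivative) (auto simp: a_def intro: continuous_on_subset[OF cont])
  then have "((\<lambda>u. integral {a..u} g) has_real_derivative g x) (at x)"
    by (subst (asm) at_within_interior) (auto simp: a_def)
  then have "((\<lambda>u. (LINT y|lborel. indicator {..<a} y * g y) + integral {a..u} g) has_real_derivative g x) (at x)"
    by (auto intro!: derivative_eq_intros)
  then show ?thesis
    by (rule has_field_derivative_transform_within_open[where S = "{a<..}"]) (auto simp: split a_def)
qed

lemma has_real_derivative_integral_greaterThan:
  fixes g :: "real \<Rightarrow> real"
  assumes cont: "continuous_on UNIV g" and int: "integrable lborel g"
  shows "((\<lambda>x. LINT y|lborel. indicator {x<..} y * g y) has_real_derivative - g x) (at x)"
proof -
  have int_ind: "integrable lborel (\<lambda>y. indicator {..u} y * g y)" for u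
    using integrable_mult_indicator[OF _ int, of "{..u}"] by simp
  have "(LINT y|lborel. indicator {u<..} y * g y) = (LINT y|lborel. g y) - (LINT y|lborel. indicator {..u} y * g y)" for u
  proof -
    have "(LINT y|lborel. indicator {u<..} y * g y) = (LINT y|lborel. g y - indicator {..u} y * g y)"
      by (intro Bochner_Integration.integral_cong) (auto simp: indicator_def)
    also have "\<dots> = (LINT y|lborel. g y) - (LINT y|lborel. indicator {..u} y * g y)"
      by (intro Bochner_Integration.integral_diff int int_ind)
    finally show ?thesis .
  qed
  then show ?thesis
    by (auto intro!: derivative_eq_intros has_real_derivative_integral_atMost[OF cont int])
qed

text \<open>The square of \<open>sech\<close> decays like \<open>exp (- 2 * \<bar>x\<bar>)\<close>,
  which beats the exponential and leaves a decay rate \<open>b = 2 - \<bar>a\<bar> > 0\<close>.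
  Bounding the remainder by \<open>sech (b * x)\<close> reduces the claim to
  \<open>sech_decay\<close> at the rescaled argument.\<close>

lemma decaying_exp_sech_square:
  assumes "\<bar>a\<bar> < 2"
  shows "decaying (\<lambda>y. exp (a * y) * (sech y)\<^sup>2)"
proof -
  define b where "b = 2 - \<bar>a\<bar>"
  have b: "b > 0" "b \<le> 2" using assms by (auto simp: b_def)
  show ?thesis
  proof (rule decayingI)
    fix x :: real
    have "(sech x)\<^sup>2 \<le> (2 * exp (- \<bar>x\<bar>))\<^sup>2"
      by (intro power_mono sech_le_exp_abs) (simp add: sech_pos less_imp_le)
    also have "\<dots> = 4 * exp (- 2 * \<bar>x\<bar>)"
      by (simp add: power_mult_distrib exp_double[symmetric])
    finally have 1: "(sech x)\<^sup>2 \<le> 4 * exp (- 2 * \<bar>x\<bar>)" .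
    have "a * x \<le> \<bar>a\<bar> * \<bar>x\<bar>"
      by (metis abs_ge_self abs_mult)
    then have "exp (a * x) \<le> exp (\<bar>a\<bar> * \<bar>x\<bar>)"
      by simp
    with 1 have "exp (a * x) * (sech x)\<^sup>2 \<le> exp (\<bar>a\<bar> * \<bar>x\<bar>) * (4 * exp (- 2 * \<bar>x\<bar>))"
      by (intro mult_mono) auto
    also have "\<dots> = 4 * exp (- \<bar>b * x\<bar>)"
    proof -
      have "\<bar>b * x\<bar> = 2 * \<bar>x\<bar> - \<bar>a\<bar> * \<bar>x\<bar>"
        unfolding abs_mult[of b x] abs_of_pos[OF b(1)] by (simp add: b_def left_diff_distrib)
      then show ?thesis
        by (simp flip: exp_add)
    qed
    also have "\<dots> \<le> 4 * sech (b * x)"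
      by (intro mult_left_mono exp_abs_le_sech) auto
    finally have 2: "exp (a * x) * (sech x)\<^sup>2 \<le> 4 * sech (b * x)" .
    \<comment> \<open>Since \<open>b \<le> 2\<close>, the weight in \<open>x\<close> is bounded by
      \<open>4 / b\<^sup>2\<close> times the weight in \<open>b * x\<close>.\<close>
    have b4: "b\<^sup>2 \<le> 4"
      using power_mono[of b 2 2] b by simp
    have "1 + x\<^sup>2 = (b\<^sup>2 + (b * x)\<^sup>2) / b\<^sup>2"
      using b by (simp add: field_simps)
    also have "\<dots> \<le> (4 * (1 + (b * x)\<^sup>2)) / b\<^sup>2"
    proof (rule divide_right_mono)
      show "b\<^sup>2 + (b * x)\<^sup>2 \<le> 4 * (1 + (b * x)\<^sup>2)"
        using b4 zero_le_power2[of "b * x"] unfolding distrib_left by linarith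
    qed simp
    finally have 3: "1 + x\<^sup>2 \<le> 4 / b\<^sup>2 * (1 + (b * x)\<^sup>2)"
      by simp
    have "\<bar>exp (a * x) * (sech x)\<^sup>2\<bar> * (1 + x\<^sup>2) = exp (a * x) * (sech x)\<^sup>2 * (1 + x\<^sup>2)"
      by (simp add: abs_mult)
    also have "\<dots> \<le> (4 * sech (b * x)) * (4 / b\<^sup>2 * (1 + (b * x)\<^sup>2))"
      using sech_pos[of "b * x"] by (intro mult_mono[OF 2 3]) auto
    also have "\<dots> = 16 / b\<^sup>2 * (sech (b * x) * (1 + (b * x)\<^sup>2))"
      by simp
    also have "\<dots> \<le> 16 / b\<^sup>2 * 32"
      by (intro mult_left_mono sech_decay) auto
    finally show "\<bar>exp (a * x) * (sech x)\<^sup>2\<bar> * (1 + x\<^sup>2) \<le> 16 / b\<^sup>2 * 32" .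
  qed (intro continuous_intros)
qed

text \<open>This is the integral obtained by differentiating the kernel of \<open>Tfun\<close> in
  \<open>x\<close> under the integral sign. That it is the derivative is shown in
  \<open>DERIV_Tfun\<close>; the integral form makes its boundedness immediate.\<close>

definition Tderiv :: "real \<Rightarrow> real" where
  "Tderiv x = sqrt 2 * (LINT y|lborel. sgn (y - x) * exp (- sqrt 2 * \<bar>x - y\<bar>) * (sech y)\<^sup>2)"

lemma sqrt2_less_2: "\<bar>sqrt 2\<bar> < 2" "\<bar>- sqrt 2\<bar> < 2"
  using real_sqrt_less_mono[of 2 4] by auto

lemma sech_measurable [measurable]: "sech \<in> borel_measurable borel"
  unfolding sech_def[abs_def] by (intro borel_measurable_continuous_onI continuous_intros) auto

text \<open>On each side of \<open>y = x\<close> the kernel factors into a function of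
  \<open>x\<close> times a function of \<open>y\<close>. The variable \<open>x\<close> then occurs
  only in exponentials outside the integrals and in the limits of integration, which makes
  \<open>Tfun\<close> and \<open>Tderiv\<close> easy to differentiate.\<close>

lemma Tfun_split:
  defines "A \<equiv> \<lambda>x. LINT y|lborel. indicator {..x} y * (exp (sqrt 2 * y) * (sech y)\<^sup>2)"
    and "B \<equiv> \<lambda>x. LINT y|lborel. indicator {x<..} y * (exp (- sqrt 2 * y) * (sech y)\<^sup>2)"
  shows "Tfun x = exp (- sqrt 2 * x) * A x + exp (sqrt 2 * x) * B x" (is ?T)
    and "Tderiv x = sqrt 2 * (exp (sqrt 2 * x) * B x - exp (- sqrt 2 * x) * A x)" (is ?T')
proof -
  have intA: "integrable lborel (\<lambda>y. indicator {..x} y * (exp (sqrt 2 * y) * (sech y)\<^sup>2))"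
    using integrable_mult_indicator[OF _ decaying_integrable[OF decaying_exp_sech_square[OF sqrt2_less_2(1)]], of "{..x}"]
    by simp
  have intB: "integrable lborel (\<lambda>y. indicator {x<..} y * (exp (- sqrt 2 * y) * (sech y)\<^sup>2))"
    using integrable_mult_indicator[OF _ decaying_integrable[OF decaying_exp_sech_square[OF sqrt2_less_2(2)]], of "{x<..}"]
    by simp
  have kernel: "exp (- sqrt 2 * \<bar>x - y\<bar>) = (if y \<le> x then exp (- sqrt 2 * x) * exp (sqrt 2 * y)
      else exp (sqrt 2 * x) * exp (- sqrt 2 * y))" for y
    by (simp add: right_diff_distrib flip: exp_add)
  have "Tfun x = (LINT y|lborel. exp (- sqrt 2 * x) * (indicator {..x} y * (exp (sqrt 2 * y) * (sech y)\<^sup>2)) +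
      exp (sqrt 2 * x) * (indicator {x<..} y * (exp (- sqrt 2 * y) * (sech y)\<^sup>2)))"
    unfolding Tfun_def kernel
    by (intro Bochner_Integration.integral_cong) (auto simp: indicator_def)
  also have "\<dots> = exp (- sqrt 2 * x) * A x + exp (sqrt 2 * x) * B x"
    unfolding A_def B_def
    by (subst Bochner_Integration.integral_add) (use intA intB in simp_all)
  finally show ?T .
  have "(LINT y|lborel. sgn (y - x) * exp (- sqrt 2 * \<bar>x - y\<bar>) * (sech y)\<^sup>2) =
     (LINT y|lborel. exp (sqrt 2 * x) * (indicator {x<..} y * (exp (- sqrt 2 * y) * (sech y)\<^sup>2)) -
        exp (- sqrt 2 * x) * (indicator {..x} y * (exp (sqrt 2 * y) * (sech y)\<^sup>2)))"
  \<comment> \<open>At \<open>y = x\<close> the sign is 0 while the indicator of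
    \<open>{..x}\<close> is 1, so the integrands are compared off this null set only.\<close>
  proof (rule integral_cong_AE)
    have "sgn (y - x) * exp (- sqrt 2 * \<bar>x - y\<bar>) * (sech y)\<^sup>2 =
        exp (sqrt 2 * x) * (indicator {x<..} y * (exp (- sqrt 2 * y) * (sech y)\<^sup>2)) -
        exp (- sqrt 2 * x) * (indicator {..x} y * (exp (sqrt 2 * y) * (sech y)\<^sup>2))" if "y \<noteq> x" for y
      unfolding kernel using that by (cases "y < x") (simp_all add: indicator_def)
    then show "AE y in lborel. sgn (y - x) * exp (- sqrt 2 * \<bar>x - y\<bar>) * (sech y)\<^sup>2 =
        exp (sqrt 2 * x) * (indicator {x<..} y * (exp (- sqrt 2 * y) * (sech y)\<^sup>2)) -
        exp (- sqrt 2 * x) * (indicator {..x} y * (exp (sqrt 2 * y) * (sech y)\<^sup>2))"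
      using AE_lborel_singleton[of x] by (auto elim!: eventually_mono)
  qed measurable
  also have "\<dots> = exp (sqrt 2 * x) * B x - exp (- sqrt 2 * x) * A x"
    unfolding A_def B_def
    by (subst Bochner_Integration.integral_diff) (use intA intB in simp_all)
  finally show ?T'
    by (simp add: Tderiv_def)
qed

text \<open>The derivatives of \<open>A\<close> and \<open>B\<close>, weighted by the outer
  exponentials, are the squared \<open>sech\<close> with opposite signs. They cancel in the first
  derivative; in the second they add up to the inhomogeneity
  \<open>- 2 * sqrt 2 * (sech x)\<^sup>2\<close>.\<close>

lemma DERIV_Tfun: "(Tfun has_real_derivative Tderiv x) (at x)"
  and DERIV_Tderiv: "(Tderiv has_real_derivative 2 * Tfun x - 2 * sqrt 2 * (sech x)\<^sup>2) (at x)"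
proof -
  define A where "A = (\<lambda>x. LINT y|lborel. indicator {..x} y * (exp (sqrt 2 * y) * (sech y)\<^sup>2))"
  define B where "B = (\<lambda>x. LINT y|lborel. indicator {x<..} y * (exp (- sqrt 2 * y) * (sech y)\<^sup>2))"
  have A: "(A has_real_derivative exp (sqrt 2 * x) * (sech x)\<^sup>2) (at x)"
    unfolding A_def using decaying_exp_sech_square[OF sqrt2_less_2(1)]
    by (intro has_real_derivative_integral_atMost decaying_integrable) (simp_all add: decaying_def)
  have B: "(B has_real_derivative - (exp (- sqrt 2 * x) * (sech x)\<^sup>2)) (at x)"
    unfolding B_def using decaying_exp_sech_square[OF sqrt2_less_2(2)]
    by (intro has_real_derivative_integral_greaterThan decaying_integrable) (simp_all add: decaying_def)
  have T: "Tfun = (\<lambda>x. exp (- sqrt 2 * x) * A x + exp (sqrt 2 * x) * B x)"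
    "Tderiv = (\<lambda>x. sqrt 2 * (exp (sqrt 2 * x) * B x - exp (- sqrt 2 * x) * A x))"
    by (auto simp: fun_eq_iff Tfun_split A_def B_def)
  have cancel: "exp (- sqrt 2 * x) * exp (sqrt 2 * x) = 1"
    by (simp flip: exp_add)
  have sqrt2: "sqrt 2 * (sqrt 2 * y) = 2 * y" for y
    by (simp flip: mult.assoc)
  show "(Tfun has_real_derivative Tderiv x) (at x)"
    unfolding T
    by (rule derivative_eq_intros A B refl)+ (simp add: algebra_simps)
  show "(Tderiv has_real_derivative 2 * Tfun x - 2 * sqrt 2 * (sech x)\<^sup>2) (at x)"
    unfolding T
    by (rule derivative_eq_intros A B refl)+ (use cancel in \<open>simp add: algebra_simps sqrt2\<close>)
qed

lemma deriv_Tfun: "deriv Tfun = Tderiv"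
  using DERIV_Tfun by (auto intro: DERIV_imp_deriv)

text \<open>Both kernels are at most 1 in absolute value, apart from the prefactor
  \<open>sqrt 2\<close> of \<open>Tderiv\<close>, so the integral of the squared \<open>sech\<close>
  bounds them uniformly in \<open>x\<close>.\<close>

lemma bounded_cont_Tfun [decay_intros]: "bounded_cont Tfun"
  and bounded_cont_Tderiv [decay_intros]: "bounded_cont Tderiv"
proof -
  have int: "integrable lborel (\<lambda>y. (sech y)\<^sup>2)"
    unfolding power2_eq_square by (intro decaying_integrable decay_intros)
  have le: "\<bar>LINT y|lborel. f y * (sech y)\<^sup>2\<bar> \<le> (LINT y|lborel. (sech y)\<^sup>2)"
    if "\<And>y. \<bar>f y\<bar> \<le> 1" "f \<in> borel_measurable lborel" for f :: "real \<Rightarrow> real"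
  proof -
    have *: "\<bar>f y * (sech y)\<^sup>2\<bar> \<le> (sech y)\<^sup>2" for y
      using mult_right_mono[OF that(1)[of y], of "(sech y)\<^sup>2"] by (simp add: abs_mult)
    have "integrable lborel (\<lambda>y. f y * (sech y)\<^sup>2)"
      by (rule Bochner_Integration.integrable_bound[OF int])
         (use that(2) int * in \<open>auto intro!: AE_I2 borel_measurable_times borel_measurable_integrable\<close>)
    then have "norm (LINT y|lborel. f y * (sech y)\<^sup>2) \<le> (LINT y|lborel. (sech y)\<^sup>2)"
      by (intro Bochner_Integration.integral_norm_bound_integral int) (use * in auto)
    then show ?thesis by simp
  qed
  have "\<bar>Tfun x\<bar> \<le> (LINT y|lborel. (sech y)\<^sup>2)" for x
    unfolding Tfun_def by (rule le) auto
  then show "bounded_cont Tfun"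
    by (intro bounded_contI DERIV_continuous_on[OF has_field_derivative_at_within[OF DERIV_Tfun]])
  have "\<bar>Tderiv x\<bar> \<le> sqrt 2 * (LINT y|lborel. (sech y)\<^sup>2)" for x
  proof -
    have "\<bar>LINT y|lborel. (sgn (y - x) * exp (- sqrt 2 * \<bar>x - y\<bar>)) * (sech y)\<^sup>2\<bar> \<le> (LINT y|lborel. (sech y)\<^sup>2)"
      by (rule le) (auto simp: abs_mult sgn_if)
    then show ?thesis
      by (simp add: Tderiv_def abs_mult)
  qed
  then show "bounded_cont Tderiv"
    by (intro bounded_contI DERIV_continuous_on[OF has_field_derivative_at_within[OF DERIV_Tderiv]])
qed

subsection \<open>The primitive\<close>

lemma DERIV_phi3: "(phi3 has_real_derivative - phi3 x * tanh x) (at x)"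
  unfolding phi3_def[abs_def] by (auto intro!: derivative_eq_intros)

lemma deriv_phi3: "deriv phi3 x = - phi3 x * tanh x"
  using DERIV_phi3 by (rule DERIV_imp_deriv)

lemma phi3_pos: "phi3 x > 0"
  by (simp add: phi3_def sech_pos)

lemma phi3_square: "(phi3 x)\<^sup>2 = 2 * (sech x)\<^sup>2"
  by (simp add: phi3_def power_mult_distrib)

text \<open>The scaling removes \<open>sqrt 2\<close> from the differential equation, which becomes
  \<open>u'' = 2 * u - sech^2\<close>; the later identities then have rational coefficients.\<close>

definition Tscaled :: "real \<Rightarrow> real" where
  "Tscaled x = Tfun x / (2 * sqrt 2)"

definition Tscaled_deriv :: "real \<Rightarrow> real" where
  "Tscaled_deriv x = Tderiv x / (2 * sqrt 2)"

lemma DERIV_Tscaled: "(Tscaled has_real_derivative Tscaled_deriv x) (at x)"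
  unfolding Tscaled_def[abs_def] Tscaled_deriv_def by (intro DERIV_cdivide DERIV_Tfun)

lemma DERIV_Tscaled_deriv: "(Tscaled_deriv has_real_derivative 2 * Tscaled x - (sech x)\<^sup>2) (at x)"
proof -
  have "(Tscaled_deriv has_real_derivative (2 * Tfun x - 2 * sqrt 2 * (sech x)\<^sup>2) / (2 * sqrt 2)) (at x)"
    unfolding Tscaled_deriv_def[abs_def] by (intro DERIV_cdivide DERIV_Tderiv)
  then show ?thesis
    by (simp add: Tscaled_def diff_divide_distrib)
qed

lemma bounded_cont_Tscaled [decay_intros]: "bounded_cont Tscaled"
  and bounded_cont_Tscaled_deriv [decay_intros]: "bounded_cont Tscaled_deriv"
  unfolding Tscaled_def[abs_def] Tscaled_deriv_def[abs_def] divide_inverse by (intro decay_intros)+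

text \<open>The logarithmic derivative of \<open>phi3\<close> is \<open>- tanh\<close>. The factor
  \<open>x\<close> is kept next to a \<open>sech\<close> so that \<open>decay_intros\<close> can
  treat the product as one bounded function.\<close>

lemma R1_eq: "R1 x = 2 * (x * sech x) * (sech x * tanh x) - (3 - 2 * (sech x)\<^sup>2) / 2 * Tscaled x + tanh x * Tscaled_deriv x"
  using phi3_pos[of x] phi3_square[of x]
  unfolding R1_def deriv_phi3 deriv_Tfun Tscaled_def Tscaled_deriv_def
  by (simp add: field_simps power2_eq_square)

lemma R2_eq: "R2 x = (sech x)\<^sup>2 + 3 / 2 * Tscaled x - tanh x * Tscaled_deriv x"
  using phi3_pos[of x] phi3_square[of x]
  unfolding R2_def deriv_phi3 deriv_Tfun Tscaled_def Tscaled_deriv_def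
  by (simp add: field_simps power2_eq_square)

lemma Efun_eq: "Efun x = sqrt 2 * (sech x * (1/8) - ln (phi3 x) * sech x * (1/2) - x * sech x * (1/2 * tanh x))"
  unfolding Efun_def deriv_phi3 by (simp add: phi3_def algebra_simps)

lemma Ffun_eq: "Ffun x = sqrt 2 * (sech x * (1/8) + ln (phi3 x) * sech x * (1/2) - x * sech x * (1/2 * tanh x))"
  unfolding Ffun_def Efun_eq by (simp add: phi3_def algebra_simps)

lemma h31_eq: "h31 x = (sech x)\<^sup>2 * cos x - tanh x * sin x"
  using phi3_pos[of x] unfolding h31_def deriv_phi3 phi3_square by simp

lemma h32_eq: "h32 x = - tanh x * sin x"
  using phi3_pos[of x] unfolding h32_def deriv_phi3 by simp

text \<open>The coefficients were found by solving the linear system that expresses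
  \<open>Gamma_integrand / sqrt 2 - sech * cos / 2\<close> as a derivative within the span of
  \<open>sech^k tanh^j {1, x, ln phi3, T, T'} {cos, sin}\<close>.\<close>

definition Gamma_primitive :: "real \<Rightarrow> real" where
  "Gamma_primitive x = sech x * (sin x * (3/8 - 3/8 * sech x ^ 2 + 1/4 * sech x ^ 4)
       + cos x * tanh x * (- (9/8) + 1/8 * sech x ^ 2 + 5/4 * sech x ^ 4))
   + ln (phi3 x) * sech x * (sin x * (3/2 - 5/2 * sech x ^ 2 + sech x ^ 4)
       + cos x * tanh x * (3/2 - 1/2 * sech x ^ 2 + sech x ^ 4))
   + sech x * (Tscaled x * (sin x * (- 4 + 5 * sech x ^ 2 - 2 * sech x ^ 4)
       + cos x * tanh x * (- 2 + 3 * sech x ^ 2 - 2 * sech x ^ 4)))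
   + sech x * (Tscaled_deriv x * (cos x * (1 - 2 * sech x ^ 2 + 2 * sech x ^ 4)
       + sin x * tanh x * (3 - sech x ^ 2)))
   + x * sech x * (cos x * (- (1/2) + 3 * sech x ^ 2 - 6 * sech x ^ 4 + 6 * sech x ^ 6)
       + sin x * tanh x * (- (1/2) + 9 * sech x ^ 2 - 6 * sech x ^ 4))"

definition Gamma_integrand :: "real \<Rightarrow> real" where
  "Gamma_integrand x = Delta1 x * h31 x + 2 * (Delta2 x * h32 x)
     + (6 * x * tanh x * (sech x)\<^sup>2 - 7/2 * (sech x)\<^sup>2) * phi3 x * (1 - (phi3 x)\<^sup>2) * h31 x
     - 2 * (Efun x * h31 x)"

lemma decaying_Gamma_primitive: "decaying Gamma_primitive"
  unfolding Gamma_primitive_def[abs_def] by (intro decay_intros)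

lemma DERIV_ln_phi3: "((\<lambda>x. ln (phi3 x)) has_real_derivative - tanh x) (at x)"
  using phi3_pos[of x] by (auto intro!: derivative_eq_intros DERIV_phi3)


text \<open>Each summand of the integrand contains \<open>sqrt 2\<close> exactly once, through
  \<open>phi3\<close>, \<open>Efun\<close> or \<open>Ffun\<close>, after even powers of
  \<open>phi3\<close> are expressed by \<open>sech\<close>. Division by it leaves a polynomial with
  rational coefficients.\<close>

lemma Gamma_integrand_eq:
  fixes x :: real
  defines "s \<equiv> sech x" and "t \<equiv> tanh x" and "c \<equiv> cos x" and "S \<equiv> sin x" and "L \<equiv> ln (phi3 x)"
    and "u \<equiv> Tscaled x" and "v \<equiv> Tscaled_deriv x"
  defines "e \<equiv> s * (1/8) - L * s * (1/2) - x * s * (1/2 * t)"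
  defines "f \<equiv> s * (1/8) + L * s * (1/2) - x * s * (1/2 * t)"
  defines "r1 \<equiv> 2 * (x * s) * (s * t) - (3 - 2 * s\<^sup>2) / 2 * u + t * v"
  defines "r2 \<equiv> s\<^sup>2 + 3/2 * u - t * v"
  defines "q \<equiv> 1 - 2 * s\<^sup>2"
  defines "h \<equiv> s\<^sup>2 * c - t * S"
  shows "Gamma_integrand x / sqrt 2 = (f * (3 * q\<^sup>2 - 1) + s * q\<^sup>2 + 6 * s * q * r1 - 2 * s * r2) * h
    + 2 * ((f * q + s * r1 + s * q * r2) * (- t * S))
    + (6 * x * t * s\<^sup>2 - 7/2 * s\<^sup>2) * s * q * h - 2 * (e * h)"
proof -
  have eqs: "Efun x = sqrt 2 * e" "Ffun x = sqrt 2 * f" "R1 x = r1" "R2 x = r2" "1 - (phi3 x)\<^sup>2 = q"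
    "h31 x = h" "h32 x = - t * S" "phi3 x = sqrt 2 * s"
    unfolding Efun_eq Ffun_eq R1_eq R2_eq h31_eq h32_eq phi3_square
    by (simp_all add: e_def f_def r1_def r2_def q_def h_def s_def t_def c_def S_def L_def u_def v_def phi3_def)
  have "Gamma_integrand x = sqrt 2 * ((f * (3 * q\<^sup>2 - 1) + s * q\<^sup>2 + 6 * s * q * r1 - 2 * s * r2) * h
    + 2 * ((f * q + s * r1 + s * q * r2) * (- t * S))
    + (6 * x * t * s\<^sup>2 - 7/2 * s\<^sup>2) * s * q * h - 2 * (e * h))"
    \<comment> \<open>The value of \<open>phi3\<close> is substituted last, because the equation for
      \<open>1 - (phi3 x)\<^sup>2\<close> has to match first.\<close>
    unfolding Gamma_integrand_def Delta1_def Delta2_def eqs(1-7) unfolding eqs(8) s_def[symmetric] t_def[symmetric]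
    by algebra
  then show ?thesis
    by simp
qed

lemma DERIV_sech_power:
  "((\<lambda>x. sech x ^ 2) has_real_derivative - 2 * sech x ^ 2 * tanh x) (at x)"
  "((\<lambda>x. sech x ^ 4) has_real_derivative - 4 * sech x ^ 4 * tanh x) (at x)"
  "((\<lambda>x. sech x ^ 6) has_real_derivative - 6 * sech x ^ 6 * tanh x) (at x)"
  by (auto intro!: derivative_eq_intros simp: eval_nat_numeral)

text \<open>The span containing the primitive is closed under differentiation: the logarithm
  differentiates to \<open>- tanh\<close>, and the equation for \<open>Tscaled\<close> eliminates
  its second derivative. What remains is an identity modulo the relation between \<open>tanh\<close>
  and \<open>sech\<close>.\<close>

lemma DERIV_Gamma_primitive: "(Gamma_primitive has_real_derivative Gamma_integrand x / sqrt 2 - 1/2 * (sech x * cos x)) (at x)"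
proof -
  \<comment> \<open>The quotient of the difference of both sides by \<open>tanh\<^sup>2 + sech\<^sup>2 - 1\<close>; it turns the claim into a
    polynomial identity.\<close>
  define K where "K = sech x * (cos x * (- 3/8 + 1/8 * sech x ^ 2 - 29/4 * sech x ^ 4)
    + ln (phi3 x) * (cos x * (- 3/2 + 3/2 * sech x ^ 2 - 5 * sech x ^ 4))
    + Tscaled x * (cos x * (2 - 9 * sech x ^ 2 + 10 * sech x ^ 4))
    + Tscaled_deriv x * (sin x * (5 - 5 * sech x ^ 2))
    + x * (sin x * (- 1/2 + 3 * sech x ^ 2 - 12 * sech x ^ 4)))"
  have "(Gamma_primitive has_real_derivative Gamma_integrand x / sqrt 2 - 1/2 * (sech x * cos x)
      + ((tanh x)\<^sup>2 + (sech x)\<^sup>2 - 1) * K) (at x)"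
    unfolding Gamma_primitive_def[abs_def] Gamma_integrand_eq K_def
    by (rule DERIV_ln_phi3 DERIV_Tscaled DERIV_Tscaled_deriv DERIV_tanh_sech DERIV_sech_power derivative_eq_intros refl)+
       algebra
  then show ?thesis
    by (simp add: tanh_sq)
qed

section \<open>Integrability of the individual terms and evaluation of Gamma\<close>

lemma decaying_phi3 [decay_intros]: "decaying phi3"
proof -
  have "decaying (\<lambda>x. sech x * sqrt 2)"
    by (intro decay_intros)
  then show ?thesis
    by (simp add: phi3_def[abs_def] mult.commute)
qed

lemma bounded_cont_phi3 [decay_intros]: "bounded_cont phi3"
  by (rule decaying_imp_bounded_cont decaying_phi3)+

lemma bounded_cont_h31 [decay_intros]: "bounded_cont h31"
  and bounded_cont_h32 [decay_intros]: "bounded_cont h32"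
proof -
  have "bounded_cont (\<lambda>x. (sech x)\<^sup>2 * cos x - tanh x * sin x)" "bounded_cont (\<lambda>x. (- 1) * tanh x * sin x)"
    by (intro decay_intros)+
  then show "bounded_cont h31" "bounded_cont h32"
    by (simp_all add: h31_eq[abs_def] h32_eq[abs_def])
qed

lemma bounded_cont_times_sech [decay_intros]: "bounded_cont (\<lambda>x. x * sech x)"
  by (rule decaying_imp_bounded_cont decaying_times_sech)+

lemma bounded_cont_R1 [decay_intros]: "bounded_cont R1"
  and bounded_cont_R2 [decay_intros]: "bounded_cont R2"
proof -
  have "bounded_cont (\<lambda>x. 2 * (x * sech x) * (sech x * tanh x) - (3 - 2 * (sech x)\<^sup>2) * (1/2) * Tscaled x + tanh x * Tscaled_deriv x)"
    "bounded_cont (\<lambda>x. (sech x)\<^sup>2 + 3 / 2 * Tscaled x - tanh x * Tscaled_deriv x)"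
    by (intro decay_intros)+
  then show "bounded_cont R1" "bounded_cont R2"
    by (simp_all add: R1_eq[abs_def] R2_eq[abs_def])
qed

lemma decaying_Efun [decay_intros]: "decaying Efun"
  and decaying_Ffun [decay_intros]: "decaying Ffun"
  unfolding Efun_eq[abs_def] Ffun_eq[abs_def]
  by (intro decaying_bounded_mult decay_intros)+

lemma decaying_Delta1 [decay_intros]: "decaying Delta1"
  and decaying_Delta2 [decay_intros]: "decaying Delta2"
proof -
  \<comment> \<open>The summands of \<open>Delta1\<close> are rearranged to begin with
    \<open>Ffun\<close> or \<open>phi3\<close>, the decaying factor expected by
    \<open>decay_intros\<close>.\<close>
  have "decaying (\<lambda>x. Ffun x * (3 * (1 - (phi3 x)\<^sup>2)\<^sup>2 - 1) + phi3 x * (1 - (phi3 x)\<^sup>2)\<^sup>2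
      + phi3 x * (6 * (1 - (phi3 x)\<^sup>2) * R1 x) - phi3 x * (2 * R2 x))"
    "decaying (\<lambda>x. Ffun x * (1 - (phi3 x)\<^sup>2) + phi3 x * R1 x + phi3 x * (1 - (phi3 x)\<^sup>2) * R2 x)"
    by (intro decay_intros)+
  then show "decaying Delta1" "decaying Delta2"
    by (simp_all add: Delta1_def[abs_def] Delta2_def[abs_def] mult_ac)
qed

theorem theorem1p3:
  shows "Gamma_const = pi / (sqrt 2 * cosh (pi / 2))"
proof -
  define w where "w = (\<lambda>x. (6 * x * tanh x * (sech x)\<^sup>2 - 7/2 * (sech x)\<^sup>2) * phi3 x * (1 - (phi3 x)\<^sup>2))"
  \<comment> \<open>This is \<open>w\<close> with \<open>phi3\<close> moved to the front and
    \<open>x\<close> paired with one of the \<open>sech\<close> factors.\<close>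
  have "decaying (\<lambda>x. phi3 x * ((x * sech x) * (6 * tanh x * sech x) - 7/2 * (sech x)\<^sup>2) * (1 - (phi3 x)\<^sup>2))"
    by (intro decay_intros)
  then have w: "decaying w"
    by (simp add: w_def power2_eq_square mult_ac)
  have dec: "decaying (\<lambda>x. Delta1 x * h31 x)" "decaying (\<lambda>x. Delta2 x * h32 x)"
    "decaying (\<lambda>x. w x * h31 x)" "decaying (\<lambda>x. Efun x * h31 x)" "decaying (\<lambda>x. sech x * cos x)"
    by (intro decay_intros w)+
  note int = dec[THEN decaying_integrable]
  have integrand_split: "Gamma_integrand = (\<lambda>x. Delta1 x * h31 x + 2 * (Delta2 x * h32 x) + w x * h31 x - 2 * (Efun x * h31 x))"
    by (simp add: Gamma_integrand_def w_def fun_eq_iff)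
  have int_integrand: "integrable lborel Gamma_integrand"
    unfolding integrand_split by (intro Bochner_Integration.integrable_add Bochner_Integration.integrable_diff
        integrable_mult_right int)
  have "Gamma_const = (LINT x|lborel. Gamma_integrand x)"
    unfolding Gamma_const_def ip_def integrand_split w_def[symmetric]
    using int by simp
  also have "\<dots> = sqrt 2 * (LINT x|lborel. Gamma_integrand x / sqrt 2)"
    by simp
  also have "(LINT x|lborel. Gamma_integrand x / sqrt 2) = 1/2 * (LINT x|lborel. sech x * cos x)"
  proof -
    \<comment> \<open>The integrand is the derivative of the decaying
      \<open>Gamma_primitive\<close>, so only the \<open>sech x * cos x\<close> part contributes to
      Gamma.\<close>
    have "(LINT x|lborel. Gamma_integrand x / sqrt 2 - 1/2 * (sech x * cos x)) = 0"
      by (rule integral_deriv_decaying[OF decaying_Gamma_primitive _ DERIV_Gamma_primitive]) (use int_integrand int in simp)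
    then show ?thesis
      using int_integrand int by simp
  qed
  also have "sqrt 2 * (1/2 * (LINT x|lborel. sech x * cos x)) = pi / (sqrt 2 * cosh (pi / 2))"
    unfolding integral_sech_cos by (simp add: field_simps)
  finally show ?thesis .
qed

end
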